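(* Let $\alpha = -2+\sqrt{6}$. For every integer $n\ge 1$, all coins in $[n]$ can be identified in at most $\lceil \log_2 n\rceil + \lceil \log_{\alpha^{-1}} n\rceil$ weighings.
   Context: Write $[n]=\{1,2,\ldots,n\}$. There are $n$ coins labelled $1,\ldots,n$. It is known to the audience that the coins weigh $1,2,\ldots,n$ grams in some order, i.e. that there is a permutation $w$ of $[n]$ such that the coin labelled $i$ weighs $w(i)$ grams, but the audience does not know $w$. In truth $w$ is the identity (the coin labelled $i$ weighs $i$ grams), and the person conducting the weighings knows this. A weighing is a pair $(A,B)$ of disjoint subsets of $[n]$ (coins on the left and right pans of a balance scale; the remaining coins are left out). Its outcome for a permutation $w$ is whether $\sum_{i\in A} w(i)$ is less than, equal to, or greater than $\sum_{i\in B} w(i)$. A list of weighings identifies the coin $t\in[n]$ if every permutation $w$ of $[n]$ that gives the same outcome as the identity permutation for every weighing in the list satisfies $w(t)=t$. It identifies all coins if it identifies every $t\in[n]$, i.e. the identity is the only permutation of $[n]$ consistent with the observed outcomes. *)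

theory Defs
  imports Complex_Main "HOL-Combinatorics.Permutations"
begin

type_synonym weighing = "nat set \<times> nat set"

definition is_weighing :: "nat \<Rightarrow> weighing \<Rightarrow> bool" where
  "is_weighing n W \<longleftrightarrow>
     fst W \<subseteq> {1..n} \<and> snd W \<subseteq> {1..n} \<and> fst W \<inter> snd W = {}"

datatype outcome = Less | Equal | Greater

definition outcome :: "(nat \<Rightarrow> nat) \<Rightarrow> weighing \<Rightarrow> outcome" where
  "outcome w W =
     (let l = (\<Sum>i\<in>fst W. w i); r = (\<Sum>i\<in>snd W. w i)
      in if l < r then Less else if l = r then Equal else Greater)"

definition consistent :: "weighing list \<Rightarrow> (nat \<Rightarrow> nat) \<Rightarrow> bool" where
  "consistent Ws w \<longleftrightarrow> (\<forall>W\<in>set Ws. outcome w W = outcome id W)"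

definition identifies :: "nat \<Rightarrow> weighing list \<Rightarrow> nat \<Rightarrow> bool" where
  "identifies n Ws t \<longleftrightarrow> (\<forall>w. w permutes {1..n} \<longrightarrow> consistent Ws w \<longrightarrow> w t = t)"

definition identifies_all :: "nat \<Rightarrow> weighing list \<Rightarrow> bool" where
  "identifies_all n Ws \<longleftrightarrow> (\<forall>t\<in>{1..n}. identifies n Ws t)"

end

theory Submission
  imports Defs "HOL-Library.Infinite_Set"
begin

text \<open>
  Some coins are first made into known weights, and these then keep the scale in balance while the
  order of all the other coins is refined.

  \<^emph>\<open>Reference coins.\<close> Consider the chain n, \<lceil>n/2\<rceil>, \<lceil>n/4\<rceil>, \<dots>, 1. For each link p > 1 some of the
  smaller links, \<lceil>p/2\<rceil> among them, have sum exactly p - 1, and they are weighed against p. The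
  outcome "less" says w p \<ge> 1 + (sum of the smaller ones), so by induction w p \<ge> p along the
  chain. At the top w n \<le> n, hence equality holds there, and it propagates down because every
  inequality used was tight. This costs \<lceil>log 2 n\<rceil> weighings. Afterwards the set P of links consists
  of known weights, and its subset sums include every number below 2 n (lemma
  \<open>reference_coins_exist\<close>).

  \<^emph>\<open>Balanced weighings are rigid.\<close> Let u 1 < \<dots> < u M be the remaining coins, and call a cut c
  \<^emph>\<open>pinned\<close> if w (u 1) + \<dots> + w (u c) = u 1 + \<dots> + u c is forced. A weighing of these coins is a
  coefficient vector v with entries 1 (left), 0 (out) and -1 (right). By Abel summation the sum of
  v i * (w (u i) - u i) is the sum of (v c - v (c + 1)) * X c, where X c \<ge> 0 is the excess of the
  first c coins, which vanishes at pinned cuts. If v descends at every unpinned cut and the scale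
  balances, then every term vanishes, so each strict descent of v is a newly pinned cut (lemma
  \<open>balance_pins\<close>).

  \<^emph>\<open>Choosing the vector.\<close> The pinned cuts split the unknown coins into blocks. In every block put
  the a lightest coins on the left and the b heaviest on the right. Moving coins one at a time from
  a right-heavy to a left-heavy configuration changes the imbalance by at most n per move, so it can
  be stopped with an imbalance below 2 n in absolute value, and reference coins cancel that
  (lemmas \<open>split_block\<close>, \<open>split_all_blocks\<close>, \<open>refine_resolution\<close>).

  \<^emph>\<open>The rate.\<close> The only obstacle is a block at the light end: the g lightest coins on the left, of
  total weight about g^2/2, must hold out against the c heaviest of 2 g + c, of weight at most
  c (2 g + c). Equality holds for c = (1/\<alpha> - 2) g, which is where \<alpha> comes from. The c heaviest
  coins actually weigh about c^2/2 less; this leaves room up to the ratio \<surd>5 in place of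
  1/\<alpha> = 2.2247\<dots>, and the rational ratio 49/22 = 2.2272\<dots> in between is used throughout. The room
  pays for rounding and for the gaps that the reference coins leave among the u i. So one weighing
  reduces the largest block by a factor 49/22 \<ge> 1/\<alpha>, and \<lceil>log (1/\<alpha>) n\<rceil> weighings pin every cut.
\<close>

section \<open>A chain of reference coins\<close>

text \<open>
  The last clause is split so that it can be carried along the chain: the lower bounds hold for every
  positive w, whereas exactness needs a bound on the top coin, which for coin n comes from w n \<le> n
  and for a smaller link from the weighing above it.
\<close>
definition reference_coins :: "nat \<Rightarrow> weighing list \<Rightarrow> nat set \<Rightarrow> bool" where
  "reference_coins n Ws P \<longleftrightarrow>
     (\<forall>W\<in>set Ws. is_weighing n W) \<and> P \<subseteq> {1..n} \<and> 1 \<in> P \<and> n \<in> P \<and>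
     (\<forall>x < 2 * n. \<exists>Q\<subseteq>P. \<Sum>Q = x) \<and>
     (\<forall>p\<in>P. \<forall>q\<in>P. p < q \<longrightarrow> 2 * p \<le> q + 1) \<and>
     (\<forall>w. (\<forall>i\<in>{1..n}. 1 \<le> w i) \<longrightarrow> consistent Ws w \<longrightarrow>
        (\<forall>p\<in>P. p \<le> w p) \<and> (w n \<le> n \<longrightarrow> (\<forall>p\<in>P. w p = p)))"

lemma reference_coins_1: "reference_coins 1 [] {1}"
proof -
  have "\<exists>Q\<subseteq>{1}. \<Sum>Q = x" if "x < 2" for x :: nat
  proof (cases "x = 0")
    case True
    then show ?thesis by (intro exI[of _ "{}"]) simp
  next
    case False
    with that show ?thesis by (intro exI[of _ "{1}"]) simp
  qed
  then show ?thesis by (simp add: reference_coins_def)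
qed

text \<open>
  The new top coin n is weighed against h together with smaller links of total weight n - 1 - h.
  Since n - 1 - h < h, the subset sums of the old chain supply these without using h a second time.
  The coin h has to take part because exactness of the whole old chain follows from its exactness.
\<close>
lemma reference_coins_step:
  assumes ref: "reference_coins h Ws P" and h: "h < n" "n \<le> 2 * h" "2 * h \<le> n + 1"
  shows "\<exists>L. reference_coins n ((L, {n}) # Ws) (insert n P)"
proof -
  have wg: "\<And>W. W \<in> set Ws \<Longrightarrow> is_weighing h W"
    and P: "P \<subseteq> {1..h}" "1 \<in> P" "h \<in> P"
    and sums: "\<And>x. x < 2 * h \<Longrightarrow> \<exists>Q\<subseteq>P. \<Sum>Q = x"
    and dbl: "\<And>p q. p \<in> P \<Longrightarrow> q \<in> P \<Longrightarrow> p < q \<Longrightarrow> 2 * p \<le> q + 1"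
    and known: "\<And>w. \<forall>i\<in>{1..h}. 1 \<le> w i \<Longrightarrow> consistent Ws w \<Longrightarrow>
           (\<forall>p\<in>P. p \<le> w p) \<and> (w h \<le> h \<longrightarrow> (\<forall>p\<in>P. w p = p))"
    using ref unfolding reference_coins_def by simp_all
  have finP: "finite P" and nP: "n \<notin> P" using P h finite_subset[OF P(1)] by auto
  have "n - 1 - h < 2 * h" using h by linarith
  from sums[OF this] obtain L' where L': "L' \<subseteq> P" "\<Sum>L' = n - 1 - h" by blast
  have finL': "finite L'" using L' finP finite_subset by blast
  have hL': "h \<notin> L'"
  proof
    assume "h \<in> L'"
    then have "h \<le> \<Sum>L'" using finL' by (metis member_le_sum zero_le)
    then show False using L'(2) h by linarith
  qed
  define L where "L = insert h L'"
  have L: "L \<subseteq> P" "h \<in> L" "finite L" "\<Sum>L = n - 1"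
    using L' hL' finL' h P(3) unfolding L_def by auto
  have out: "outcome id (L, {n}) = Less"
    using L(4) h by (simp add: outcome_def Let_def)
  have "L \<subseteq> {1..n}" using L(1) P(1) h(1) by fastforce
  moreover have "n \<notin> L" "1 \<le> n" using L(1) nP h by auto
  ultimately have "is_weighing n (L, {n})" by (simp add: is_weighing_def)
  moreover have "is_weighing n W" if "W \<in> set Ws" for W
    proof -
    have "{1..h} \<subseteq> {1..n}" using h(1) by auto
    with wg[OF that] show ?thesis unfolding is_weighing_def by blast
  qed
  moreover have "\<exists>Q\<subseteq>insert n P. \<Sum>Q = x" if x: "x < 2 * n" for x
  proof (cases "x < n")
    case True
    then have "x < 2 * h" using h by linarith
    from sums[OF this] show ?thesis by blast
  next
    case False
    have "x - n < 2 * h" using h x False by linarith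
    from sums[OF this] obtain Q where Q: "Q \<subseteq> P" "\<Sum>Q = x - n" by blast
    then have "finite Q" "n \<notin> Q" using finP nP finite_subset by blast+
    then have "\<Sum>(insert n Q) = x" using Q False by simp
    then show ?thesis using Q by blast
  qed
  moreover have "2 * p \<le> q + 1" if "p \<in> insert n P" "q \<in> insert n P" "p < q" for p q
  proof -
    have le: "r \<le> h" if "r \<in> P" for r using that P(1) by auto
    have pP: "p \<in> P" using that le h by (metis insert_iff leD le_trans nat_less_le)
    then show ?thesis using that dbl[of p q] le[OF pP] h by (cases "q = n") auto
  qed
  moreover have "(\<forall>p\<in>insert n P. p \<le> w p) \<and> (w n \<le> n \<longrightarrow> (\<forall>p\<in>insert n P. w p = p))"
    if pos: "\<forall>i\<in>{1..n}. 1 \<le> w i" and cons: "consistent ((L, {n}) # Ws) w" for w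
  proof -
    have "\<forall>i\<in>{1..h}. 1 \<le> w i" "consistent Ws w"
      using pos cons h by (auto simp: consistent_def)
    from known[OF this] have lower: "\<And>p. p \<in> P \<Longrightarrow> p \<le> w p"
      and exact: "w h \<le> h \<Longrightarrow> \<forall>p\<in>P. w p = p" by auto
    have "outcome w (L, {n}) = Less" using cons out by (simp add: consistent_def)
    then have less: "(\<Sum>i\<in>L. w i) < w n"
      by (auto simp: outcome_def Let_def split: if_splits)
    have sumL: "\<Sum>L \<le> (\<Sum>i\<in>L. w i)" using lower L(1) by (intro sum_mono) blast
    have "n \<le> w n" using less sumL L(4) by linarith
    moreover have "\<forall>p\<in>insert n P. w p = p" if "w n \<le> n"
    proof -
      have split: "(\<Sum>i\<in>L. f i) = f h + (\<Sum>i\<in>L'. f i)" for f :: "nat \<Rightarrow> nat"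
        using hL' finL' by (simp add: L_def)
      have "\<Sum>L' \<le> (\<Sum>i\<in>L'. w i)" using lower L'(1) by (intro sum_mono) blast
      moreover have "(\<Sum>i\<in>L. w i) \<le> \<Sum>L" using less that L(4) by linarith
      ultimately have "w h \<le> h" using split[of w] split[of "\<lambda>i. i"] by linarith
      with exact \<open>n \<le> w n\<close> that show ?thesis by auto
    qed
    ultimately show ?thesis using lower by blast
  qed
  ultimately have "reference_coins n ((L, {n}) # Ws) (insert n P)"
    unfolding reference_coins_def using P h by auto
  then show ?thesis ..
qed

lemma reference_coins_exist:
  "\<lbrakk>1 \<le> n; n \<le> 2 ^ k\<rbrakk> \<Longrightarrow> \<exists>Ws P. length Ws \<le> k \<and> reference_coins n Ws P"
proof (induction k arbitrary: n)
  case (0 n)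
  then have "n = 1" by simp
  then show ?case using reference_coins_1 by auto
next
  case (Suc k n)
  show ?case
  proof (cases "n = 1")
    case True
    then show ?thesis using reference_coins_1 by (metis le0 list.size(3))
  next
    case False
    define h where "h = (n + 1) div 2"
    have h: "1 \<le> h" "h \<le> 2 ^ k" "h < n" "n \<le> 2 * h" "2 * h \<le> n + 1"
      using False Suc.prems unfolding h_def by auto
    from Suc.IH[OF h(1,2)] obtain Ws P where "length Ws \<le> k" "reference_coins h Ws P"
      by blast
    with reference_coins_step[OF _ h(3-5)] show ?thesis
      by (metis length_Cons Suc_le_mono)
  qed
qed

section \<open>The unknown coins are dense\<close>

text \<open>
  If q1 < \<dots> < ql lie above a, then doubling gives q - 1 \<ge> 2 (p - 1) for consecutive elements, so
  b - 2 \<ge> ql - 1 \<ge> 2^(l-1) a. The induction removes the largest element q: the others lie below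
  (q + 3) div 2, to which the induction hypothesis applies.
\<close>
lemma doubling_sparse:
  fixes S :: "nat set"
  assumes "finite S"
    and "\<And>p q. p \<in> S \<Longrightarrow> q \<in> S \<Longrightarrow> p < q \<Longrightarrow> 2 * p \<le> q + 1"
    and "S \<subseteq> {a<..<b}" and "2 \<le> a" and "a < b"
  shows "2 ^ card S * a + 4 \<le> 2 * b"
  using assms
proof (induction S arbitrary: b rule: finite_linorder_max_induct)
  case empty
  then show ?case by simp
next
  case (insert q S b)
  have qS: "q \<notin> S" using insert.hyps by blast
  have q: "a < q" "q < b" using insert.prems(2) by auto
  show ?case
  proof (cases "S = {}")
    case True
    then show ?thesis using q by simp
  next
    case False
    have le: "2 * p \<le> q + 1" if "p \<in> S" for p
      using insert.prems(1)[of p q] insert.hyps(2) that by auto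
    have sub: "S \<subseteq> {a<..<(q + 3) div 2}"
    proof
      fix p assume p: "p \<in> S"
      then have "a < p" using insert.prems(2) by auto
      then show "p \<in> {a<..<(q + 3) div 2}" using le[OF p] by auto
    qed
    then have "a < (q + 3) div 2" using False by fastforce
    with insert.IH[OF _ sub insert.prems(3)] insert.prems(1)
    have "2 ^ card S * a + 4 \<le> 2 * ((q + 3) div 2)" by auto
    then have "2 ^ card S * a + 1 \<le> q" by linarith
    then show ?thesis using q qS insert.hyps(1) by simp
  qed
qed

text \<open>
  A linear substitute for card S \<le> log 2 (b - a), from the chord 32 (l - 4) of 2^l through l = 5 and
  l = 6. The slope 1/32 is small enough for the narrow quadratic margin in \<open>block_surplus\<close>, and the
  constant 128 still lets that lemma hold, with equality, in its tightest case g = c = 1.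
\<close>
lemma card_doubling_le:
  fixes S :: "nat set"
  assumes "finite S"
    and "\<And>p q. p \<in> S \<Longrightarrow> q \<in> S \<Longrightarrow> p < q \<Longrightarrow> 2 * p \<le> q + 1"
    and "S \<subseteq> {a<..<b}" and "2 \<le> a" and "a < b"
  shows "32 * card S \<le> b - a + 128"
proof -
  let ?l = "card S"
  have lin: "32 * l \<le> 2 ^ l + 128" for l :: nat
  proof (cases "l \<le> 5")
    case True
    then have "l \<in> {0,1,2,3,4,5}" by auto
    then show ?thesis by auto
  next
    case False
    then have "5 \<le> l" by simp
    then show ?thesis by (induction l rule: dec_induct) auto
  qed
  have "2 ^ ?l + a \<le> b"
  proof (cases "S = {}")
    case True
    then show ?thesis using assms(5) by simp
  next
    case False
    then obtain m where m: "?l = Suc m" using assms(1) by (cases ?l) auto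
    obtain y where y: "(2::nat) ^ ?l = y + 2" using m by (metis add.commute le_add_diff_inverse one_le_numeral one_le_power power_Suc mult_le_mono2 mult.right_neutral)
    have "y * 2 \<le> y * a" using assms(4) by (rule mult_le_mono2)
    then show ?thesis
      using doubling_sparse[OF assms] unfolding y add_mult_distrib by linarith
  qed
  then show ?thesis using lin[of ?l] by linarith
qed

text \<open>
  Between u i and u j only reference coins are missing, and those are sparse; so along the unknown
  coins weight grows hardly faster than rank.
\<close>
lemma unknown_coins_dense:
  fixes u :: "nat \<Rightarrow> nat"
  assumes u: "bij_betw u {1..M} ({1..n} - P)" "strict_mono_on {1..M} u"
    and P: "1 \<in> P" "\<And>p q. p \<in> P \<Longrightarrow> q \<in> P \<Longrightarrow> p < q \<Longrightarrow> 2 * p \<le> q + 1"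
    and ij: "1 \<le> i" "i \<le> j" "j \<le> M"
  shows "31 * (u j - u i) \<le> 32 * (j - i + 4)"
proof (cases "i = j")
  case False
  with ij(2) have "i < j" by linarith
  have mem: "i \<in> {1..M}" "j \<in> {1..M}" using ij by auto
  then have ui: "u i \<in> {1..n} - P" "u j \<in> {1..n} - P" using u(1) bij_betwE by blast+
  have less: "u i < u j" using strict_mono_onD[OF u(2) mem \<open>i < j\<close>] .
  have ge2: "2 \<le> u i" using ui(1) P(1) by (cases "u i = 1") auto
  define S where "S = P \<inter> {u i<..<u j}"
  have S: "finite S" "S \<subseteq> {u i<..<u j}" unfolding S_def by auto
  have "{u i<..<u j} \<subseteq> u ` {i<..<j} \<union> S"
  proof
    fix x assume x: "x \<in> {u i<..<u j}"
    show "x \<in> u ` {i<..<j} \<union> S"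
    proof (cases "x \<in> P")
      case False
      then have "x \<in> {1..n} - P" using x ui by auto
      then obtain k where k: "k \<in> {1..M}" "x = u k" using u(1) by (metis bij_betw_imp_surj_on imageE)
      then have "i < k" "k < j"
        using x strict_mono_on_less[OF u(2)] mem by auto
      then show ?thesis using k by auto
    qed (use x in \<open>auto simp: S_def\<close>)
  qed
  then have "card {u i<..<u j} \<le> card (u ` {i<..<j} \<union> S)"
    using S by (intro card_mono) auto
  also have "\<dots> \<le> card (u ` {i<..<j}) + card S" by (rule card_Un_le)
  also have "\<dots> \<le> card {i<..<j} + card S" using card_image_le[of "{i<..<j}" u] by simp
  finally have "u j - u i \<le> j - i + card S" using \<open>i < j\<close> by simp
  moreover have "32 * card S \<le> u j - u i + 128"
    using card_doubling_le[OF S(1) _ S(2) ge2 less] P(2) unfolding S_def by blast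
  moreover have "31 * d \<le> 32 * (e + 4)" if "d \<le> e + r" "32 * r \<le> d + 128" for d e r :: nat
    using that by presburger
  ultimately show ?thesis by blast
qed simp

section \<open>Splitting one block with bounded imbalance\<close>

lemma strict_mono_gap:
  fixes u :: "nat \<Rightarrow> nat"
  assumes "strict_mono_on {1..M} u" and "1 \<le> i" and "i + k \<le> M"
  shows "u i + k \<le> u (i + k)"
  using assms(3)
proof (induction k)
  case 0
  then show ?case by simp
next
  case (Suc k)
  have "u (i + k) < u (i + Suc k)"
    using strict_mono_onD[OF assms(1), of "i + k" "i + Suc k"] assms(2) Suc.prems by simp
  with Suc show ?case by simp
qed

lemma sum_lightest_ge:
  fixes u :: "nat \<Rightarrow> nat"
  assumes "strict_mono_on {1..M} u" and "s + k \<le> M" and "s < M"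
  shows "2 * k * u (s + 1) + k * k \<le> 2 * (\<Sum>i\<in>{s<..s+k}. u i) + k"
  using assms(2)
proof (induction k)
  case 0
  then show ?case by simp
next
  case (Suc k)
  have "{s<..s + Suc k} = insert (s + Suc k) {s<..s+k}" by auto
  moreover have "u (s + 1) + k \<le> u (s + Suc k)"
    using strict_mono_gap[OF assms(1), of "s + 1" k] Suc.prems by simp
  ultimately show ?case using Suc by (simp add: algebra_simps)
qed

lemma sum_heaviest_le:
  fixes u :: "nat \<Rightarrow> nat"
  assumes "strict_mono_on {1..M} u" and "k \<le> t" and "t \<le> M"
  shows "2 * (\<Sum>i\<in>{t-k<..t}. u i) + k * k \<le> 2 * k * u t + k"
  using assms(2)
proof (induction k)
  case 0
  then show ?case by simp
next
  case (Suc k)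
  have "{t - Suc k<..t} = insert (t - k) {t-k<..t}" using Suc.prems by auto
  moreover have "u (t - k) + k \<le> u t"
    using strict_mono_gap[OF assms(1), of "t - k" k] Suc.prems assms(3) by simp
  ultimately show ?case using Suc by (simp add: algebra_simps)
qed

text \<open>
  A discrete intermediate value argument: the last point of a path before it leaves the region below
  K is either positive or the end of the path.
\<close>
lemma last_step_below:
  fixes f :: "nat \<Rightarrow> int"
  assumes "f 0 \<le> K" and "\<And>j. j < N \<Longrightarrow> f (Suc j) \<le> f j + K"
  shows "\<exists>j\<le>N. f j \<le> K \<and> (0 < f j \<or> j = N)"
  using assms(2)
proof (induction N)
  case 0
  then show ?case using assms(1) by auto
next
  case (Suc N)
  then obtain j where j: "j \<le> N" "f j \<le> K" "0 < f j \<or> j = N" by (metis less_SucI)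
  show ?case
  proof (cases "0 < f j")
    case True
    then show ?thesis using j by (intro exI[of _ j]) simp
  next
    case False
    then have "f (Suc N) \<le> K" using j Suc.prems[of N] by simp
    then show ?thesis by (intro exI[of _ "Suc N"]) simp
  qed
qed

text \<open>
  Twice the statement that the g lightest coins of a block of 2 g + c coins are lighter than its c
  heaviest by at most 2 per coin of the block. Here U is the lightest weight, U + d the heaviest, and
  the coins on either side are only known to be distinct integers, which yields the terms g * g and
  c * c. For c = 5 g / 22 and d = 32 (2 g + c) / 31 the quadratic terms alone leave a surplus of about
  0.003 g^2 (before doubling); the linear terms are covered by the allowance of 2 per coin.
\<close>
lemma block_surplus:
  fixes g c U d :: nat
  assumes "1 \<le> c" and "22 * c \<le> 5 * g + 21" and "1 \<le> U" and "31 * d \<le> 32 * (2 * g + c + 3)"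
  shows "2 * c * (U + d) + c + g \<le> 2 * g * U + g * g + c * c + 4 * (2 * g + c)"
proof (cases "g \<le> 1")
  case True
  then have "g = 1" "c = 1" using assms(1,2) by linarith+
  then show ?thesis using assms(4) by simp
next
  case False
  then have g: "2 \<le> g" by simp
  have cg: "c \<le> g" using assms(2) g by linarith
  obtain r where r: "g = c + r" using cg le_Suc_ex by blast
  \<comment> \<open>Once the goal is multiplied by 31 and the bound on d inserted, the terms to be absorbed increase
    with c; so c may be replaced by its upper bound C / 22 in them.\<close>
  define C where "C = 5 * g + 21"
  have C: "22 * c \<le> C" using assms(2) by (simp add: C_def)
  have cc: "484 * (c * c) \<le> C * C" using mult_mono[OF C C] by simp
  have cG: "22 * (c * g) \<le> C * g" using mult_le_mono1[OF C, of g] by (simp add: mult.assoc)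
  have gg: "2 * g \<le> g * g" using mult_le_mono1[OF g, of g] .
  have lin: "484 * (33 * x + 161 * c + 128 * y) \<le> 33 * x' + 3542 * C + 2816 * y'"
    if "484 * x \<le> x'" "22 * y \<le> y'" for x x' y y'
    using that C by simp
  have "484 * (33 * (c * c) + 161 * c + 128 * (c * g)) \<le> 33 * (C * C) + 3542 * C + 2816 * (C * g)"
    by (rule lin[OF cc cG])
  also have "\<dots> \<le> 484 * (31 * (g * g) + 279 * g)"
    using g gg unfolding C_def by (simp add: algebra_simps)
  finally have key: "33 * (c * c) + 161 * c + 128 * (c * g) \<le> 31 * (g * g) + 279 * g" by simp
  have "c * (31 * d) \<le> c * (32 * (2 * g + c + 3))" using assms(4) by (rule mult_le_mono2)
  then have cd: "31 * (c * d) \<le> 64 * (c * g) + 32 * (c * c) + 96 * c"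
    by (simp add: algebra_simps)
  have rU: "r \<le> r * U" using assms(3) by simp
  have lin': "2 * A + 2 * y + c + g \<le> 2 * A + 2 * B + G + x + 8 * g + 4 * c"
    if "33 * x + 161 * c + 128 * z \<le> 31 * G + 279 * g" "31 * y \<le> 64 * z + 32 * x + 96 * c" "r \<le> B"
    for A B G x y z
    using that r by linarith
  show ?thesis
    using lin'[OF key cd rU, of "c * U"] unfolding r by (simp add: algebra_simps)
qed

text \<open>
  The running imbalance D, accumulated over the blocks below s, is kept between -2 s and n. The upper
  bound n is the length of a single move of the path, so the path can always be stopped before it is
  exceeded; the lower bound pays for the deficit of at most 2 per coin from \<open>block_surplus\<close> in case
  the path never reaches a positive imbalance.
\<close>
lemma split_block:
  fixes u :: "nat \<Rightarrow> nat" and D :: int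
  assumes mono: "strict_mono_on {1..M} u"
    and range: "\<And>i. i \<in> {1..M} \<Longrightarrow> 1 \<le> u i \<and> u i \<le> n"
    and dense: "\<And>i j. 1 \<le> i \<Longrightarrow> i \<le> j \<Longrightarrow> j \<le> M \<Longrightarrow> 31 * (u j - u i) \<le> 32 * (j - i + 4)"
    and block: "s < t" "t \<le> M" "t - s \<le> 2 * g + (5 * g + 21) div 22"
    and D: "- 2 * int s \<le> D" "D \<le> int n"
  shows "\<exists>a b. a \<le> g \<and> b \<le> g \<and> a + b \<le> t - s \<and> t - s \<le> a + b + g \<and>
    - 2 * int t \<le> D + int (\<Sum>i\<in>{s<..s+a}. u i) - int (\<Sum>i\<in>{t-b<..t}. u i) \<and>
    D + int (\<Sum>i\<in>{s<..s+a}. u i) - int (\<Sum>i\<in>{t-b<..t}. u i) \<le> int n"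
proof -
  define m where "m = t - s"
  \<comment> \<open>The path runs from c coins left and e right to e left and c right, first adding coins on the left,
    then removing them on the right. All along it a + b \<ge> m - g, so the middle piece is small enough.
    Truncated subtraction gives c = 0 for m \<le> 2 g and e = 0 for m \<le> g.\<close>
  define c where "c = m - 2 * g"
  define e where "e = min g (m - g)"
  have m: "m \<le> 2 * g + (5 * g + 21) div 22" "t = s + m" "1 \<le> m"
    using block unfolding m_def by auto
  have c22: "22 * c \<le> 5 * g + 21" using m(1) unfolding c_def by linarith
  have ce: "c \<le> e"
    using m(1) unfolding c_def e_def by linarith
  have ecm: "e + c + g \<le> m \<or> (e = 0 \<and> c = 0)" "m \<le> e + c + g" "2 * e \<le> m"
    unfolding c_def e_def by linarith+
  define low where "low a = (\<Sum>i\<in>{s<..s+a}. u i)" for a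
  define top where "top b = (\<Sum>i\<in>{t-b<..t}. u i)" for b
  define a where "a j = min (c + j) e" for j
  define b where "b j = e - (c + j - e)" for j
  define f where "f j = D + int (low (a j)) - int (top (b j))" for j
  define N where "N = 2 * (e - c)"
  have bnd: "a j \<le> e" "b j \<le> e" for j unfolding a_def b_def by auto
  have tot: "e + c \<le> a j + b j" if "j \<le> N" for j
    using that ce unfolding a_def b_def N_def by linarith

  have start: "f 0 \<le> int n"
  proof -
    have "low c \<le> top e"
    proof (cases "c = 0")
      case True
      then show ?thesis by (simp add: low_def)
    next
      case False
      have cm: "c + e \<le> m" using ecm False by linarith
      have "low c \<le> card {s<..s+c} * u (s + c)" unfolding low_def
      proof (rule sum_bounded_above[where 'a = nat, simplified])
        fix i assume "i \<in> {s<..s+c}"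
        then show "u i \<le> u (s + c)"
          using strict_mono_gap[OF mono, of i "s + c - i"] m cm block by auto
      qed
      also have "\<dots> \<le> e * u (s + c)" using ce by simp
      also have "\<dots> = card {t-e<..t} * u (s + c)" using cm m by simp
      also have "\<dots> \<le> top e" unfolding top_def
      proof (rule sum_bounded_below[where 'a = nat, simplified])
        fix i assume "i \<in> {t-e<..t}"
        then show "u (s + c) \<le> u i"
          using strict_mono_gap[OF mono, of "s + c" "i - (s + c)"] m cm block False by auto
      qed
      finally show ?thesis .
    qed
    moreover have "a 0 = c" "b 0 = e" using ce unfolding a_def b_def by auto
    ultimately show ?thesis using D(2) unfolding f_def by simp
  qed

  have step: "f (Suc j) \<le> f j + int n" for j
  proof (cases "c + j < e")
    case True
    then have ab: "a (Suc j) = Suc (a j)" "b (Suc j) = b j" unfolding a_def b_def by auto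
    have "{s<..s + Suc (a j)} = insert (s + Suc (a j)) {s<..s + a j}" by auto
    moreover have "u (s + Suc (a j)) \<le> n"
      using range[of "s + Suc (a j)"] True ecm(3) m block unfolding a_def by auto
    ultimately have "low (Suc (a j)) \<le> low (a j) + n" unfolding low_def by simp
    then show ?thesis unfolding f_def ab by simp
  next
    case False
    then have aj: "a (Suc j) = a j" unfolding a_def by simp
    show ?thesis
    proof (cases "b j = 0")
      case True
      then have "b (Suc j) = b j" unfolding b_def by simp
      then show ?thesis unfolding f_def aj by simp
    next
      case bj: False
      then have b_Suc: "b j = Suc (b (Suc j))" using False unfolding b_def by simp
      define k where "k = b (Suc j)"
      have kt: "k < t" using bnd(2)[of j] ecm(3) m unfolding b_Suc k_def by linarith
      then have "{t - Suc k<..t} = insert (t - k) {t-k<..t}" by auto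
      moreover have "t - k \<in> {1..M}" using kt block(2) by (simp add: le_diff_conv)
      then have "u (t - k) \<le> n" using range by blast
      ultimately have "top (Suc k) \<le> top k + n" unfolding top_def by simp
      then show ?thesis unfolding f_def aj b_Suc k_def by simp
    qed
  qed

  have finish: "- 2 * int t \<le> f N"
  proof -
    have ab: "a N = e" "b N = c" using ce unfolding a_def b_def N_def by auto
    have "top c \<le> low e + 2 * m"
    proof (cases "c = 0")
      case True
      then show ?thesis by (simp add: top_def)
    next
      case False
      then have e: "e = g" and mg: "m = 2 * g + c" and g: "1 \<le> g"
        using c22 unfolding c_def e_def by auto
      have U: "1 \<le> u (s + 1)" using range[of "s + 1"] block by auto
      have incr: "u (s + 1) \<le> u t"
        using strict_mono_gap[OF mono, of "s + 1" "t - (s + 1)"] block by simp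
      have d: "31 * (u t - u (s + 1)) \<le> 32 * (2 * g + c + 3)"
        using dense[of "s + 1" t] block m mg g by simp
      have "2 * g * u (s + 1) + g * g \<le> 2 * low g + g"
        unfolding low_def by (rule sum_lightest_ge[OF mono]) (use m mg block in auto)
      moreover have "2 * top c + c * c \<le> 2 * c * u t + c"
        unfolding top_def by (rule sum_heaviest_le[OF mono]) (use m mg block in auto)
      moreover have "2 * c * u t + c + g \<le> 2 * g * u (s + 1) + g * g + c * c + 4 * (2 * g + c)"
        using block_surplus[OF _ c22 U d] False incr by simp
      ultimately show ?thesis unfolding e mg by linarith
    qed
    then show ?thesis using D(1) m(2) unfolding f_def ab by simp
  qed

  obtain j where j: "j \<le> N" "f j \<le> int n" "0 < f j \<or> j = N"
    using last_step_below[OF start step] by blast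
  have "- 2 * int t \<le> f j" using j(3) finish by auto
  moreover have "e \<le> g" unfolding e_def by simp
  ultimately show ?thesis
    using j bnd[of j] tot[of j] ecm m(2)
    unfolding f_def low_def top_def
    by (intro exI[of _ "a j"] exI[of _ "b j"]) linarith
qed

section \<open>Splitting all blocks at once\<close>

text \<open>
  C is the set of known cuts. Blocks are treated from the light end upwards, each one correcting the
  imbalance inherited from those below. If no block ever makes it positive, the deficits add up, but to
  at most 2 per coin treated; hence the lower bound proportional to t.
\<close>
lemma split_all_blocks:
  fixes u :: "nat \<Rightarrow> nat"
  assumes mono: "strict_mono_on {1..M} u"
    and range: "\<And>i. i \<in> {1..M} \<Longrightarrow> 1 \<le> u i \<and> u i \<le> n"
    and dense: "\<And>i j. 1 \<le> i \<Longrightarrow> i \<le> j \<Longrightarrow> j \<le> M \<Longrightarrow> 31 * (u j - u i) \<le> 32 * (j - i + 4)"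
    and C: "0 \<in> C" "\<And>i. i < M \<Longrightarrow> \<exists>c\<in>C. i < c \<and> c \<le> i + (2 * g + (5 * g + 21) div 22)"
    and t: "t \<in> C" "t \<le> M"
  shows "\<exists>v :: nat \<Rightarrow> int. (\<forall>i. v i \<in> {-1, 0, 1}) \<and>
    (\<forall>c\<in>{1..<t} - C. v (Suc c) \<le> v c) \<and>
    (\<forall>i<t. \<exists>c. i < c \<and> c \<le> i + g \<and> c \<le> t \<and> (c \<in> C \<or> v (Suc c) < v c)) \<and>
    - 2 * int t \<le> (\<Sum>i\<in>{1..t}. v i * int (u i)) \<and>
    (\<Sum>i\<in>{1..t}. v i * int (u i)) \<le> int n"
  using t
proof (induction t rule: less_induct)
  case (less t)
  show ?case
  proof (cases "t = 0")
    case True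
    then show ?thesis by (intro exI[of _ "\<lambda>_. 0"]) simp
  next
    case False
    define s where "s = Max {c \<in> C. c < t}"
    have "s \<in> {c \<in> C. c < t}" unfolding s_def
      using False C(1) by (intro Max_in) auto
    then have s: "s \<in> C" "s < t" by auto
    have s_max: "c \<le> s" if "c \<in> C" "c < t" for c
      unfolding s_def using that by (intro Max_ge) auto
    obtain c where "c \<in> C" "s < c" "c \<le> s + (2 * g + (5 * g + 21) div 22)"
      using C(2)[of s] s less.prems(2) by auto
    with s_max[of c] have size: "t - s \<le> 2 * g + (5 * g + 21) div 22" by fastforce
    have "s \<le> M" using s(2) less.prems(2) by simp
    from less.IH[OF s(2,1) this] obtain v :: "nat \<Rightarrow> int" where v: "\<forall>i. v i \<in> {-1, 0, 1}"
      and v_anti: "\<forall>c\<in>{1..<s} - C. v (Suc c) \<le> v c"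
      and v_gap: "\<forall>i<s. \<exists>c. i < c \<and> c \<le> i + g \<and> c \<le> s \<and> (c \<in> C \<or> v (Suc c) < v c)"
      and v_sum: "- 2 * int s \<le> (\<Sum>i\<in>{1..s}. v i * int (u i))"
        "(\<Sum>i\<in>{1..s}. v i * int (u i)) \<le> int n"
      by (elim exE conjE)
    from split_block[OF mono range dense s(2) less.prems(2) size v_sum]
    obtain a b where ab: "a \<le> g" "b \<le> g" "a + b \<le> t - s" "t - s \<le> a + b + g"
      and sum_ab: "- 2 * int t \<le> (\<Sum>i\<in>{1..s}. v i * int (u i))
          + int (\<Sum>i\<in>{s<..s+a}. u i) - int (\<Sum>i\<in>{t-b<..t}. u i)"
        "(\<Sum>i\<in>{1..s}. v i * int (u i))
          + int (\<Sum>i\<in>{s<..s+a}. u i) - int (\<Sum>i\<in>{t-b<..t}. u i) \<le> int n"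
      by blast
    define v' where "v' i = (if i \<le> s then v i else if i \<le> s + a then 1
      else if t - b < i then -1 else 0)" for i
    have sab: "s + a \<le> t - b" "t - b \<le> t" using ab s by auto
    have "v' i \<in> {-1, 0, 1}" for i using v[rule_format, of i] unfolding v'_def by auto
    moreover have "v' (Suc c) \<le> v' c" if c: "c \<in> {1..<t} - C" for c
    proof (cases "c < s")
      case True
      then show ?thesis using bspec[OF v_anti, of c] c unfolding v'_def by auto
    next
      case False
      then have "s < c" using c s by (metis DiffD2 linorder_neqE_nat)
      then show ?thesis unfolding v'_def by auto
    qed
    moreover have "\<exists>c. i < c \<and> c \<le> i + g \<and> c \<le> t \<and> (c \<in> C \<or> v' (Suc c) < v' c)"
      if i: "i < t" for i
    proof -
      consider "i < s" | "s \<le> i" "i < s + a" | "s + a \<le> i" "i < t - b" | "t - b \<le> i" "s \<le> i"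
        using sab by linarith
      then show ?thesis
      proof cases
        case 1
        from v_gap[rule_format, OF this] obtain c where c: "i < c" "c \<le> i + g" "c \<le> s"
          "c \<in> C \<or> v (Suc c) < v c" by blast
        show ?thesis
        proof (cases "c = s")
          case True
          then show ?thesis using c s by (intro exI[of _ s]) auto
        next
          case False
          then show ?thesis using c s by (intro exI[of _ c]) (auto simp: v'_def)
        qed
      next
        case 2
        then show ?thesis using ab sab s less.prems(1)
          by (cases "s + a = t") (auto simp: v'_def intro!: exI[of _ "s + a"])
      next
        case 3
        then show ?thesis using ab sab s less.prems(1)
          by (cases "b = 0") (auto simp: v'_def intro!: exI[of _ "t - b"])
      next
        case 4
        then show ?thesis using ab sab s less.prems(1) i by (intro exI[of _ t]) auto
      qed
    qed
    moreover have "(\<Sum>i\<in>{1..t}. v' i * int (u i)) = (\<Sum>i\<in>{1..s}. v i * int (u i))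
          + int (\<Sum>i\<in>{s<..s+a}. u i) - int (\<Sum>i\<in>{t-b<..t}. u i)"
    proof -
      have "{1..t} = {1..s} \<union> {s<..t}" using s by auto
      then have "(\<Sum>i\<in>{1..t}. v' i * int (u i)) =
          (\<Sum>i\<in>{1..s}. v' i * int (u i)) + (\<Sum>i\<in>{s<..t}. v' i * int (u i))"
        by (simp only:) (rule sum.union_disjoint; auto)
      also have "(\<Sum>i\<in>{1..s}. v' i * int (u i)) = (\<Sum>i\<in>{1..s}. v i * int (u i))"
        by (intro sum.cong) (auto simp: v'_def)
      also have "(\<Sum>i\<in>{s<..t}. v' i * int (u i)) =
          (\<Sum>i\<in>{s<..t}. (if i \<in> {s<..s+a} then int (u i) else 0)
                     - (if i \<in> {t-b<..t} then int (u i) else 0))"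
        using sab by (intro sum.cong) (auto simp: v'_def)
      also have "\<dots> = (\<Sum>i\<in>{s<..t} \<inter> {s<..s+a}. int (u i)) - (\<Sum>i\<in>{s<..t} \<inter> {t-b<..t}. int (u i))"
        by (simp add: sum_subtractf sum.inter_restrict del: Int_greaterThanAtMost)
      also have "{s<..t} \<inter> {s<..s+a} = {s<..s+a}" using sab by auto
      also have "{s<..t} \<inter> {t-b<..t} = {t-b<..t}" using sab by auto
      finally show ?thesis by simp
    qed
    ultimately show ?thesis using sum_ab by (intro exI[of _ v']) auto
  qed
qed

section \<open>A balanced weighing pins its descents\<close>

lemma sum_initial_segment_le:
  fixes u y :: "nat \<Rightarrow> nat"
  assumes u: "strict_mono_on {1..M} u" and y: "inj_on y {1..M}" "y ` {1..M} \<subseteq> u ` {1..M}"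
    and c: "c \<le> M"
  shows "(\<Sum>i\<in>{1..c}. u i) \<le> (\<Sum>i\<in>{1..c}. y i)"
proof (cases "c = 0")
  case False
  define A where "A = y ` {1..c}"
  define U where "U = u ` {1..c}"
  have sub: "{1..c} \<subseteq> {1..M}" using c by auto
  have inj: "inj_on u {1..c}" "inj_on y {1..c}"
    using strict_mono_on_imp_inj_on[OF u] y(1) sub inj_on_subset by blast+
  have fin: "finite A" "finite U" unfolding A_def U_def by auto
  have "card A = card U" unfolding A_def U_def using inj by (simp add: card_image)
  then have card: "card (A - U) = card (U - A)"
    using card_Diff_subset_Int[of A U] card_Diff_subset_Int[of U A] fin by (simp add: Int_commute)
  have "\<Sum>(U - A) \<le> card (U - A) * u c"
  proof (rule sum_bounded_above[where 'a = nat, simplified])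
    fix x assume "x \<in> U - A"
    then obtain i where i: "x = u i" "1 \<le> i" "i \<le> c" unfolding U_def by auto
    then have "u i + (c - i) \<le> u c" using strict_mono_gap[OF u, of i "c - i"] c by simp
    then show "x \<le> u c" using i(1) by linarith
  qed
  also have "\<dots> \<le> \<Sum>(A - U)" unfolding card[symmetric]
  proof (rule sum_bounded_below[where 'a = nat, simplified])
    fix x assume x: "x \<in> A - U"
    then have "x \<in> u ` {1..M}" using y(2) sub unfolding A_def by blast
    then obtain i where i: "x = u i" "i \<in> {1..M}" by auto
    then have "c < i" using x unfolding U_def by (metis DiffD2 atLeastAtMost_iff image_eqI not_le)
    then show "u c \<le> x" using strict_mono_gap[OF u, of c "i - c"] i False by simp
  qed
  finally have "\<Sum>(U - A) \<le> \<Sum>(A - U)" .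
  moreover have "\<Sum>U = \<Sum>(U \<inter> A) + \<Sum>(U - A)" "\<Sum>A = \<Sum>(A \<inter> U) + \<Sum>(A - U)"
    using fin by (simp_all add: sum.Int_Diff)
  ultimately have "\<Sum>U \<le> \<Sum>A" by (simp add: Int_commute)
  then show ?thesis unfolding U_def A_def using inj by (simp add: sum.reindex)
qed simp

lemma abel_summation:
  fixes v x :: "nat \<Rightarrow> int"
  shows "(\<Sum>i\<in>{1..M}. v i * x i) =
    v M * (\<Sum>i\<in>{1..M}. x i) + (\<Sum>c\<in>{1..<M}. (v c - v (Suc c)) * (\<Sum>i\<in>{1..c}. x i))"
proof (induction M)
  case (Suc M)
  then show ?case by (cases "M = 0") (simp_all add: algebra_simps)
qed simp

text \<open>
  The argument of a rearrangement inequality: among the arrangements y of the u i, a vector that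
  descends outside the known cuts has its minimal inner product at y = u, and equality leaves no
  excess at any strict descent.
\<close>
lemma balance_pins:
  fixes u y :: "nat \<Rightarrow> nat" and v :: "nat \<Rightarrow> int"
  assumes u: "strict_mono_on {1..M} u" and y: "inj_on y {1..M}" "y ` {1..M} \<subseteq> u ` {1..M}"
    and C: "M \<in> C" "\<And>c. c \<in> C \<Longrightarrow> (\<Sum>i\<in>{1..c}. y i) = (\<Sum>i\<in>{1..c}. u i)"
    and anti: "\<And>c. c \<in> {1..<M} - C \<Longrightarrow> v (Suc c) \<le> v c"
    and bal: "(\<Sum>i\<in>{1..M}. v i * int (y i)) = (\<Sum>i\<in>{1..M}. v i * int (u i))"
    and c: "c \<in> {1..<M}" "v (Suc c) < v c"
  shows "(\<Sum>i\<in>{1..c}. y i) = (\<Sum>i\<in>{1..c}. u i)"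
proof -
  define X where "X k = (\<Sum>i\<in>{1..k}. int (y i) - int (u i))" for k
  have X: "X k = int (\<Sum>i\<in>{1..k}. y i) - int (\<Sum>i\<in>{1..k}. u i)" for k
    unfolding X_def by (simp add: sum_subtractf)
  have nonneg: "0 \<le> (v k - v (Suc k)) * X k" if k: "k \<in> {1..<M}" for k
  proof (cases "k \<in> C")
    case True
    then show ?thesis using C(2) by (simp add: X)
  next
    case False
    have "0 \<le> X k" using sum_initial_segment_le[OF u y, of k] k by (simp add: X del: of_nat_sum)
    then show ?thesis using anti[of k] False k by simp
  qed
  have "(\<Sum>i\<in>{1..M}. v i * (int (y i) - int (u i))) = 0"
    using bal by (simp add: right_diff_distrib sum_subtractf)
  moreover have "(\<Sum>i\<in>{1..M}. v i * (int (y i) - int (u i))) =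
      v M * X M + (\<Sum>k\<in>{1..<M}. (v k - v (Suc k)) * X k)"
    unfolding X_def by (rule abel_summation)
  moreover have "X M = 0" using C(2)[OF C(1)] by (simp add: X del: of_nat_sum)
  ultimately have "(\<Sum>k\<in>{1..<M}. (v k - v (Suc k)) * X k) = 0" by simp
  then have "(v c - v (Suc c)) * X c = 0"
    using nonneg c(1) by (subst (asm) sum_nonneg_eq_0_iff) auto
  then show ?thesis using c(2) by (simp add: X del: of_nat_sum)
qed

section \<open>Refining the resolution\<close>

definition pins :: "nat \<Rightarrow> (nat \<Rightarrow> nat) \<Rightarrow> weighing list \<Rightarrow> nat \<Rightarrow> bool" where
  "pins n u Ws c \<longleftrightarrow> (\<forall>w. w permutes {1..n} \<longrightarrow> consistent Ws w \<longrightarrow>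
     (\<Sum>i\<in>{1..c}. w (u i)) = (\<Sum>i\<in>{1..c}. u i))"

text \<open>
  Blocks between consecutive pinned cuts have at most g coins. Quantifying over all i < M instead of
  over consecutive cuts says the same, since the cut 0 is always pinned.
\<close>
definition resolves :: "nat \<Rightarrow> (nat \<Rightarrow> nat) \<Rightarrow> nat \<Rightarrow> weighing list \<Rightarrow> nat \<Rightarrow> bool" where
  "resolves n u M Ws g \<longleftrightarrow>
     (\<forall>i<M. \<exists>c. i < c \<and> c \<le> i + g \<and> c \<le> M \<and> pins n u Ws c)"

lemma fixing_permutes_image:
  assumes "w permutes {1..n}" and "\<forall>p\<in>P. w p = p"
  shows "w ` ({1..n} - P) \<subseteq> {1..n} - P"
proof
  fix y assume "y \<in> w ` ({1..n} - P)"
  then obtain x where x: "x \<in> {1..n}" "x \<notin> P" "y = w x" by auto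
  moreover have "w x \<notin> P" using x assms permutes_inj[OF assms(1)] by (metis injD)
  ultimately show "y \<in> {1..n} - P" using permutes_in_image[OF assms(1)] by auto
qed

lemma pins_all:
  assumes u: "bij_betw u {1..M} ({1..n} - P)"
    and known: "\<And>w. w permutes {1..n} \<Longrightarrow> consistent Ws w \<Longrightarrow> \<forall>p\<in>P. w p = p"
  shows "pins n u Ws M"
  unfolding pins_def
proof (intro allI impI)
  fix w assume w: "w permutes {1..n}" "consistent Ws w"
  have "inj_on w ({1..n} - P)" using permutes_inj_on[OF w(1)] .
  then have "w ` ({1..n} - P) = {1..n} - P"
    using fixing_permutes_image[OF w(1) known[OF w]] by (intro endo_inj_surj) auto
  with \<open>inj_on w _\<close> have "(\<Sum>x\<in>{1..n} - P. w x) = \<Sum>({1..n} - P)"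
    by (metis (mono_tags, lifting) sum.reindex_cong)
  then show "(\<Sum>i\<in>{1..M}. w (u i)) = (\<Sum>i\<in>{1..M}. u i)"
    using sum.reindex_bij_betw[OF u, of w] sum.reindex_bij_betw[OF u, of "\<lambda>x. x"] by simp
qed

lemma signed_sum_eq:
  fixes v :: "nat \<Rightarrow> int" and x :: "nat \<Rightarrow> nat"
  assumes "\<And>i. v i \<in> {-1, 0, 1}"
  shows "(\<Sum>i\<in>{1..M}. v i * int (x i)) =
    int (\<Sum>i\<in>{i\<in>{1..M}. v i = 1}. x i) - int (\<Sum>i\<in>{i\<in>{1..M}. v i = -1}. x i)"
proof -
  have "v i * int (x i) = (if v i = 1 then int (x i) else 0) - (if v i = -1 then int (x i) else 0)" for i
    using assms[of i] by auto
  then show ?thesis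
    by (simp only: of_nat_sum sum.inter_filter[OF finite_atLeastAtMost]
        sum_subtractf if_distrib[of int] of_nat_0)
qed

text \<open>
  The vector from \<open>split_all_blocks\<close> is balanced exactly by a set Q of reference coins on the lighter
  pan. Their weights are known, so they do not disturb the argument of \<open>balance_pins\<close>. Subset sums up
  to 2 n - 1 suffice because n itself is a reference coin, whence M < n and the imbalance is at least
  -2 (n - 1).
\<close>
lemma refine_resolution:
  assumes u: "bij_betw u {1..M} ({1..n} - P)" "strict_mono_on {1..M} u"
    and dense: "\<And>i j. 1 \<le> i \<Longrightarrow> i \<le> j \<Longrightarrow> j \<le> M \<Longrightarrow> 31 * (u j - u i) \<le> 32 * (j - i + 4)"
    and P: "P \<subseteq> {1..n}" "n \<in> P" "\<And>x. x < 2 * n \<Longrightarrow> \<exists>Q\<subseteq>P. \<Sum>Q = x"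
    and known: "\<And>w. w permutes {1..n} \<Longrightarrow> consistent Ws w \<Longrightarrow> \<forall>p\<in>P. w p = p"
    and res: "resolves n u M Ws (2 * g + (5 * g + 21) div 22)"
  shows "\<exists>W. is_weighing n W \<and> resolves n u M (W # Ws) g"
proof -
  define C where "C = {c. c \<le> M \<and> pins n u Ws c}"
  have C0: "0 \<in> C" unfolding C_def pins_def by simp
  have CM: "M \<in> C" using pins_all[OF u(1) known] unfolding C_def by simp
  have u_mem: "u i \<in> {1..n}" "u i \<notin> P" if "i \<in> {1..M}" for i
    using bij_betwE[OF u(1)] that by auto
  have u_inj: "inj_on u {1..M}" using u(1) bij_betw_def by blast
  have "M = card ({1..n} - P)" using bij_betw_same_card[OF u(1)] by simp
  also have "\<dots> < card {1..n}" using P(1,2) by (intro psubset_card_mono) auto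
  finally have Mn: "M < n" by simp
  have range: "1 \<le> u i \<and> u i \<le> n" if "i \<in> {1..M}" for i
    using u_mem(1)[OF that] by auto
  have gap: "\<exists>c\<in>C. i < c \<and> c \<le> i + (2 * g + (5 * g + 21) div 22)" if "i < M" for i
    using res that unfolding resolves_def C_def by blast
  have "\<exists>v :: nat \<Rightarrow> int. (\<forall>i. v i \<in> {-1, 0, 1}) \<and>
    (\<forall>c\<in>{1..<M} - C. v (Suc c) \<le> v c) \<and>
    (\<forall>i<M. \<exists>c. i < c \<and> c \<le> i + g \<and> c \<le> M \<and> (c \<in> C \<or> v (Suc c) < v c)) \<and>
    - 2 * int M \<le> (\<Sum>i\<in>{1..M}. v i * int (u i)) \<and>
    (\<Sum>i\<in>{1..M}. v i * int (u i)) \<le> int n"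
    by (rule split_all_blocks[OF u(2) _ _ C0 _ CM order_refl]) (fact range dense gap)+
  then obtain v :: "nat \<Rightarrow> int" where v_all: "\<forall>i. v i \<in> {-1, 0, 1}"
    and anti_all: "\<forall>c\<in>{1..<M} - C. v (Suc c) \<le> v c"
    and v_gap: "\<forall>i<M. \<exists>c. i < c \<and> c \<le> i + g \<and> c \<le> M \<and> (c \<in> C \<or> v (Suc c) < v c)"
    and D_bounds: "- 2 * int M \<le> (\<Sum>i\<in>{1..M}. v i * int (u i))"
      "(\<Sum>i\<in>{1..M}. v i * int (u i)) \<le> int n"
    by (elim exE conjE)
  note v = v_all[rule_format] and anti = anti_all[rule_format]
  define D where "D = (\<Sum>i\<in>{1..M}. v i * int (u i))"
  have "nat \<bar>D\<bar> < 2 * n" using D_bounds Mn unfolding D_def by linarith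
  from P(3)[OF this] obtain Q where Q: "Q \<subseteq> P" "\<Sum>Q = nat \<bar>D\<bar>" by blast
  have finQ: "finite Q" using finite_subset[OF subset_trans[OF Q(1) P(1)]] by simp
  define I where "I e = {i\<in>{1..M}. v i = e}" for e
  define A where "A = u ` I 1 \<union> (if D < 0 then Q else {})"
  define B where "B = u ` I (-1) \<union> (if D < 0 then {} else Q)"
  have uI: "u ` I e \<subseteq> {1..n} - P" for e using u_mem unfolding I_def by auto
  have "I 1 \<inter> I (-1) = {}" "I e \<subseteq> {1..M}" for e unfolding I_def by auto
  then have "u ` I 1 \<inter> u ` I (-1) = {}"
    using inj_on_image_Int[OF u_inj, of "I 1" "I (-1)"] by simp
  then have W: "is_weighing n (A, B)"
    using uI[of 1] uI[of "-1"] Q(1) P(1) unfolding is_weighing_def A_def B_def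
    by (auto split: if_splits)
  have balance: "int (\<Sum>x\<in>A. w x) - int (\<Sum>x\<in>B. w x) =
      (\<Sum>i\<in>{1..M}. v i * int (w (u i))) + (if D < 0 then 1 else -1) * int (\<Sum>x\<in>Q. w x)"
    for w :: "nat \<Rightarrow> nat"
  proof -
    have fin: "finite (u ` I e)" for e unfolding I_def by simp
    have disj: "u ` I e \<inter> Q = {}" for e using uI[of e] Q(1) by blast
    have re: "(\<Sum>x\<in>u ` I e. w x) = (\<Sum>i\<in>I e. w (u i))" for e
    proof -
      have "inj_on u (I e)" using u_inj by (rule inj_on_subset) (auto simp: I_def)
      then show ?thesis by (simp add: sum.reindex)
    qed
    have un: "(\<Sum>x\<in>u ` I e \<union> Q. w x) = (\<Sum>i\<in>I e. w (u i)) + (\<Sum>x\<in>Q. w x)" for e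
      unfolding re[symmetric] by (rule sum.union_disjoint[OF fin finQ disj])
    show ?thesis
      unfolding signed_sum_eq[OF v] I_def[symmetric] A_def B_def
      by (simp add: re un del: of_nat_sum)
  qed
  have "int (\<Sum>x\<in>A. id x) - int (\<Sum>x\<in>B. id x) = 0"
    using balance[of id] Q(2) unfolding D_def[symmetric] id_apply by auto
  then have outcome_id: "outcome id (A, B) = Equal"
    by (simp add: outcome_def Let_def del: of_nat_sum)
  have new: "pins n u ((A, B) # Ws) c" if c: "c \<in> {1..<M}" "v (Suc c) < v c" for c
    unfolding pins_def
  proof (intro allI impI)
    fix w assume w: "w permutes {1..n}" and cons: "consistent ((A, B) # Ws) w"
    then have cons': "consistent Ws w" by (simp add: consistent_def)
    have wP: "\<forall>p\<in>P. w p = p" using known[OF w cons'] .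
    have "outcome w (A, B) = Equal" using cons outcome_id by (simp add: consistent_def)
    then have "(\<Sum>x\<in>A. w x) = (\<Sum>x\<in>B. w x)"
      by (auto simp: outcome_def Let_def split: if_splits)
    moreover have "(\<Sum>x\<in>Q. w x) = \<Sum>Q" using wP Q(1) by (intro sum.cong) auto
    ultimately have bal: "(\<Sum>i\<in>{1..M}. v i * int (w (u i))) = D"
      using balance[of w] Q(2) by (auto simp del: of_nat_sum split: if_splits)
    have "w ` u ` {1..M} \<subseteq> u ` {1..M}"
      using fixing_permutes_image[OF w wP] u(1) unfolding bij_betw_def by simp
    moreover have "inj_on (\<lambda>i. w (u i)) {1..M}"
      using u_inj permutes_inj[OF w] unfolding inj_on_def inj_def by blast
    moreover have "(\<Sum>i\<in>{1..k}. w (u i)) = (\<Sum>i\<in>{1..k}. u i)" if "k \<in> C" for k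
      using that w cons' unfolding C_def pins_def by blast
    ultimately show "(\<Sum>i\<in>{1..c}. w (u i)) = (\<Sum>i\<in>{1..c}. u i)"
      using balance_pins[OF u(2) _ _ CM _ anti _ c, where y = "\<lambda>i. w (u i)"] bal
      unfolding D_def by (simp add: image_image)
  qed
  have old: "pins n u ((A, B) # Ws) c" if "c \<in> C" for c
    using that unfolding C_def pins_def consistent_def by simp
  have "resolves n u M ((A, B) # Ws) g"
    unfolding resolves_def
  proof (intro allI impI)
    fix i assume "i < M"
    with v_gap obtain c where c: "i < c" "c \<le> i + g" "c \<le> M" "c \<in> C \<or> v (Suc c) < v c" by blast
    have "pins n u ((A, B) # Ws) c"
    proof (cases "c \<in> C")
      case False
      then have "c \<noteq> M" using CM by blast
      then show ?thesis using new[of c] c False by auto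
    qed (rule old)
    with c show "\<exists>c. i < c \<and> c \<le> i + g \<and> c \<le> M \<and> pins n u ((A, B) # Ws) c" by blast
  qed
  with W show ?thesis by blast
qed

section \<open>Counting the weighings\<close>

text \<open>
  A block of this size is reduced to single coins by q applications of \<open>refine_resolution\<close>. The
  recursion is multiplication by 49/22, rounded up.
\<close>
primrec capacity :: "nat \<Rightarrow> nat" where
  "capacity 0 = 1"
| "capacity (Suc q) = 2 * capacity q + (5 * capacity q + 21) div 22"

lemma capacity_ge: "(49 / 22) ^ q \<le> real (capacity q)"
proof (induction q)
  case (Suc q)
  have "49 * capacity q \<le> 22 * capacity (Suc q)" by simp
  then have "49 * real (capacity q) \<le> 22 * real (capacity (Suc q))"
    by (metis of_nat_le_iff of_nat_mult of_nat_numeral)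
  then show ?case using Suc by simp
qed simp

lemma resolve_completely:
  assumes u: "bij_betw u {1..M} ({1..n} - P)" "strict_mono_on {1..M} u"
    and dense: "\<And>i j. 1 \<le> i \<Longrightarrow> i \<le> j \<Longrightarrow> j \<le> M \<Longrightarrow> 31 * (u j - u i) \<le> 32 * (j - i + 4)"
    and P: "P \<subseteq> {1..n}" "n \<in> P" "\<And>x. x < 2 * n \<Longrightarrow> \<exists>Q\<subseteq>P. \<Sum>Q = x"
  shows "\<lbrakk>\<And>w. w permutes {1..n} \<Longrightarrow> consistent Ws w \<Longrightarrow> \<forall>p\<in>P. w p = p;
      resolves n u M Ws (capacity q)\<rbrakk> \<Longrightarrow>
    \<exists>Vs. length Vs = q \<and> (\<forall>W\<in>set Vs. is_weighing n W) \<and> resolves n u M (Vs @ Ws) 1"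
proof (induction q arbitrary: Ws)
  case 0
  then show ?case by simp
next
  case (Suc q Ws)
  have res: "resolves n u M Ws (2 * capacity q + (5 * capacity q + 21) div 22)"
    using Suc.prems(2) by simp
  have "\<exists>W. is_weighing n W \<and> resolves n u M (W # Ws) (capacity q)"
    by (rule refine_resolution[OF u _ P(1,2)]) (fact dense P(3) Suc.prems(1) res)+
  then obtain W where W: "is_weighing n W" "resolves n u M (W # Ws) (capacity q)" by blast
  have "\<forall>p\<in>P. w p = p" if "w permutes {1..n}" "consistent (W # Ws) w" for w
    using Suc.prems(1)[OF that(1)] that(2) by (simp add: consistent_def)
  from Suc.IH[OF this W(2)] obtain Vs where "length Vs = q"
    "\<forall>W\<in>set Vs. is_weighing n W" "resolves n u M (Vs @ W # Ws) 1" by blast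
  then show ?case using W(1) by (intro exI[of _ "Vs @ [W]"]) auto
qed

text \<open>
  With every cut pinned, consecutive prefix sums differ by the weight of a single coin, so each
  unknown coin is identified.
\<close>
lemma identifies_all_in:
  assumes n: "1 \<le> n" "n \<le> 2 ^ k" "n \<le> capacity q"
  shows "\<exists>Ws. (\<forall>W\<in>set Ws. is_weighing n W) \<and> identifies_all n Ws \<and> length Ws \<le> k + q"
proof -
  from reference_coins_exist[OF n(1,2)] obtain Ws P
    where Ws: "length Ws \<le> k" and ref: "reference_coins n Ws P" by blast
  have wg: "\<forall>W\<in>set Ws. is_weighing n W" and P: "P \<subseteq> {1..n}" "1 \<in> P" "n \<in> P"
    and sums: "\<And>x. x < 2 * n \<Longrightarrow> \<exists>Q\<subseteq>P. \<Sum>Q = x"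
    and dbl: "\<And>p q. p \<in> P \<Longrightarrow> q \<in> P \<Longrightarrow> p < q \<Longrightarrow> 2 * p \<le> q + 1"
    using ref unfolding reference_coins_def by simp_all
  have known: "\<forall>p\<in>P. w p = p" if w: "w permutes {1..n}" "consistent Ws w" for w
  proof -
    have w_in: "w i \<in> {1..n}" if "i \<in> {1..n}" for i
      using permutes_in_image[OF w(1)] that by simp
    then have "\<forall>i\<in>{1..n}. 1 \<le> w i" "w n \<le> n" using n(1) by auto
    with ref w(2) show ?thesis unfolding reference_coins_def by blast
  qed
  define M where "M = card ({1..n} - P)"
  obtain h where h: "bij_betw h {..<M} ({1..n} - P)" "strict_mono_on {..<M} h"
    unfolding M_def by (rule ex_bij_betw_strict_mono_card[of "{1..n} - P"]) auto
  define u where "u i = h (i - 1)" for i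
  have "bij_betw (\<lambda>i. i - 1) {1..M} {..<M}"
    by (rule bij_betw_byWitness[where f' = Suc]) auto
  then have u: "bij_betw u {1..M} ({1..n} - P)"
    using bij_betw_trans[OF _ h(1)] unfolding u_def comp_def by blast
  have u_mono: "strict_mono_on {1..M} u"
  proof (rule strict_mono_onI)
    fix i j assume "i \<in> {1..M}" "j \<in> {1..M}" "i < j"
    then show "u i < u j"
      unfolding u_def by (intro strict_mono_onD[OF h(2)]) auto
  qed
  note dense = unknown_coins_dense[OF u u_mono P(2) dbl]
  have "M \<le> n" unfolding M_def using card_mono[of "{1..n}" "{1..n} - P"] by simp
  then have "resolves n u M Ws (capacity q)"
    using pins_all[OF u known] n(3) unfolding resolves_def by (intro allI impI exI[of _ M]) simp
  with resolve_completely[OF u u_mono dense P(1,3) sums known] obtain Vs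
    where Vs: "length Vs = q" "\<forall>W\<in>set Vs. is_weighing n W" "resolves n u M (Vs @ Ws) 1"
    by blast
  have pins: "pins n u (Vs @ Ws) c" if "c \<le> M" for c
  proof (cases c)
    case 0
    then show ?thesis by (simp add: pins_def)
  next
    case (Suc i)
    with Vs(3) that obtain c' where "i < c'" "c' \<le> i + 1" "pins n u (Vs @ Ws) c'"
      unfolding resolves_def by (metis Suc_le_lessD)
    with Suc show ?thesis by (metis Suc_eq_plus1 Suc_leI le_antisym)
  qed
  have "w t = t" if t: "t \<in> {1..n}" and w: "w permutes {1..n}" "consistent (Vs @ Ws) w" for t w
  proof (cases "t \<in> P")
    case True
    then show ?thesis using known[OF w(1)] w(2) by (simp add: consistent_def)
  next
    case False
    then obtain c where c: "c \<in> {1..M}" "t = u c"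
      using t u by (metis DiffI bij_betw_imp_surj_on imageE)
    then obtain i where i: "c = Suc i" by (cases c) auto
    have "(\<Sum>j\<in>{1..k}. w (u j)) = (\<Sum>j\<in>{1..k}. u j)" if "k \<le> M" for k
      using pins[OF that] w unfolding pins_def by blast
    from this[of c] this[of i] show ?thesis using c i by simp
  qed
  then have "identifies_all n (Vs @ Ws)" unfolding identifies_all_def identifies_def by blast
  then show ?thesis using Vs wg Ws by (intro exI[of _ "Vs @ Ws"]) auto
qed

lemma le_power_ceiling_log:
  assumes "1 < b" and "1 \<le> n"
  shows "real n \<le> b ^ nat \<lceil>log b (real n)\<rceil>"
proof -
  have "0 \<le> log b (real n)" using assms by simp
  then have "log b (real n) \<le> real (nat \<lceil>log b (real n)\<rceil>)" by linarith
  then have "real n \<le> b powr real (nat \<lceil>log b (real n)\<rceil>)"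
    using assms log_le_iff[of b "real n"] by fastforce
  also have "\<dots> = b ^ nat \<lceil>log b (real n)\<rceil>"
    using assms(1) by (intro powr_realpow) simp
  finally show ?thesis .
qed

theorem theorem6:
  fixes n :: nat and \<alpha> :: real
  defines "\<alpha> \<equiv> - 2 + sqrt 6"
  assumes "n \<ge> 1"
  shows "\<exists>Ws :: weighing list.
           (\<forall>W\<in>set Ws. is_weighing n W) \<and>
           identifies_all n Ws \<and>
           int (length Ws) \<le> \<lceil>log 2 (real n)\<rceil> + \<lceil>log (inverse \<alpha>) (real n)\<rceil>"
proof -
  define k where "k = nat \<lceil>log 2 (real n)\<rceil>"
  define q where "q = nat \<lceil>log (inverse \<alpha>) (real n)\<rceil>"
  have "120 / 49 < sqrt 6" "sqrt 6 < 5 / 2"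
    by (rule real_less_rsqrt real_less_lsqrt; simp add: power2_eq_square)+
  then have \<alpha>: "22 / 49 \<le> \<alpha>" "\<alpha> < 1" unfolding \<alpha>_def by simp_all
  then have inv: "1 < inverse \<alpha>" "inverse \<alpha> \<le> 49 / 22"
    using le_imp_inverse_le[OF \<alpha>(1)] by (simp_all add: one_less_inverse)
  have "real n \<le> 2 ^ k" unfolding k_def using assms by (intro le_power_ceiling_log) auto
  then have k: "n \<le> 2 ^ k" by (metis of_nat_le_iff of_nat_numeral of_nat_power)
  have "real n \<le> inverse \<alpha> ^ q"
    unfolding q_def using assms inv by (intro le_power_ceiling_log) auto
  also have "\<dots> \<le> (49 / 22) ^ q" using inv \<alpha> by (intro power_mono) auto
  also have "\<dots> \<le> real (capacity q)" by (rule capacity_ge)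
  finally have q: "n \<le> capacity q" by simp
  have "0 \<le> log 2 (real n)" "0 \<le> log (inverse \<alpha>) (real n)" using assms inv by simp_all
  then have "int (k + q) = \<lceil>log 2 (real n)\<rceil> + \<lceil>log (inverse \<alpha>) (real n)\<rceil>"
    unfolding k_def q_def by simp
  with identifies_all_in[OF assms(2) k q] show ?thesis by (metis of_nat_mono)
qed

end
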